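(* Let $\mathcal S$ be a matrix convex set in $\bigcup_n(M_n)^d_{sa}$. Assume that there are a constant $C>0$ and $k$ rank one real $d\times d$ matrices $\lambda^{(1)},\dots,\lambda^{(k)}$ such that $I_d\in\operatorname{conv}\{\lambda^{(1)},\dots,\lambda^{(k)}\}$ and such that $\lambda^{(m)}\mathcal S_1\subseteq C\,\mathcal S_1$ for all $1\le m\le k$. Then for every other matrix convex set $\mathcal T$ in $\bigcup_n(M_n)^d_{sa}$ we have $$\mathcal S_1\subseteq\mathcal T_1\ \Longrightarrow\ \mathcal S\subseteq C\,\mathcal T.$$
   Context: $(M_n)^d_{sa}$ is the set of $d$-tuples of self-adjoint $n\times n$ complex matrices. A set $\mathcal S=\bigcup_n\mathcal S_n$ with $\mathcal S_n\subseteq(M_n)^d_{sa}$ is matrix convex if it is closed under direct sums and under unital completely positive maps (if $X\in\mathcal S_n$ and $\phi:M_n\to M_k$ is UCP then $(\phi(X_1),\dots,\phi(X_d))\in\mathcal S_k$). The first level $\mathcal S_1$ is a subset of $\mathbb R^d$, on which $d\times d$ matrices act as usual on column vectors. $C\,\mathcal T=\{CX:X\in\mathcal T\}$; inclusion means inclusion at every level $n$. *)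

theory Defs
  imports "HOL-Analysis.Analysis" "Jordan_Normal_Form.Schur_Decomposition"
begin

text \<open>
  A \<open>d\<close>-tuple of matrices is a function \<open>'d \<Rightarrow> complex mat\<close> on a finite index type \<open>'d\<close>
  (so \<open>d = CARD('d) \<ge> 1\<close>).  A set \<open>\<S> = \<Union>\<^sub>n \<S>\<^sub>n\<close> is given by the family of its levels
  \<open>S :: nat \<Rightarrow> ('d \<Rightarrow> complex mat) set\<close>.  Levels are numbered from 1; the value \<open>S 0\<close> is irrelevant.
\<close>

definition sa_tuples :: "nat \<Rightarrow> ('d::finite \<Rightarrow> complex mat) set" where
  "sa_tuples n = {X. \<forall>i. X i \<in> carrier_mat n n \<and> mat_adjoint (X i) = X i}"

text \<open>
  In the next definition \<open>\<le>\<close> is the partial order on the complex numbers in which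
  \<open>0 \<le> z\<close> means that \<open>z\<close> is real and nonnegative, and \<open>v \<bullet>c w = (\<Sum>i. v\<^sub>i * cnj w\<^sub>i)\<close>.
\<close>

definition psd :: "nat \<Rightarrow> complex mat \<Rightarrow> bool" where
  "psd n A \<longleftrightarrow> A \<in> carrier_mat n n \<and> (\<forall>v\<in>carrier_vec n. 0 \<le> (A *\<^sub>v v) \<bullet>c v)"

definition linear_mat_map :: "nat \<Rightarrow> nat \<Rightarrow> (complex mat \<Rightarrow> complex mat) \<Rightarrow> bool" where
  "linear_mat_map n k \<phi> \<longleftrightarrow>
     (\<forall>A\<in>carrier_mat n n. \<phi> A \<in> carrier_mat k k) \<and>
     (\<forall>A\<in>carrier_mat n n. \<forall>B\<in>carrier_mat n n. \<phi> (A + B) = \<phi> A + \<phi> B) \<and>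
     (\<forall>A\<in>carrier_mat n n. \<forall>c. \<phi> (c \<cdot>\<^sub>m A) = c \<cdot>\<^sub>m \<phi> A)"

text \<open>
  An element of \<open>M\<^sub>m(M\<^sub>n)\<close> is represented as an \<open>mn \<times> mn\<close> matrix whose \<open>(i, j)\<close> block
  (\<open>i, j < m\<close>) is the following \<open>n \<times> n\<close> matrix; \<open>ampliation m n k \<phi>\<close> is
  \<open>id \<otimes> \<phi> : M\<^sub>m(M\<^sub>n) \<rightarrow> M\<^sub>m(M\<^sub>k)\<close>, which applies \<open>\<phi>\<close> to each block.
\<close>

definition block :: "nat \<Rightarrow> complex mat \<Rightarrow> nat \<Rightarrow> nat \<Rightarrow> complex mat" where
  "block n A i j = Matrix.mat n n (\<lambda>(r, c). A $$ (i * n + r, j * n + c))"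

definition ampliation ::
    "nat \<Rightarrow> nat \<Rightarrow> nat \<Rightarrow> (complex mat \<Rightarrow> complex mat) \<Rightarrow> complex mat \<Rightarrow> complex mat" where
  "ampliation m n k \<phi> A =
     Matrix.mat (m * k) (m * k)
       (\<lambda>(r, c). \<phi> (block n A (r div k) (c div k)) $$ (r mod k, c mod k))"

definition completely_positive :: "nat \<Rightarrow> nat \<Rightarrow> (complex mat \<Rightarrow> complex mat) \<Rightarrow> bool" where
  "completely_positive n k \<phi> \<longleftrightarrow>
     linear_mat_map n k \<phi> \<and>
     (\<forall>m\<ge>1. \<forall>A. psd (m * n) A \<longrightarrow> psd (m * k) (ampliation m n k \<phi> A))"

definition ucp :: "nat \<Rightarrow> nat \<Rightarrow> (complex mat \<Rightarrow> complex mat) \<Rightarrow> bool" where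
  "ucp n k \<phi> \<longleftrightarrow> completely_positive n k \<phi> \<and> \<phi> (1\<^sub>m n) = 1\<^sub>m k"

definition tuple_direct_sum ::
    "('d::finite \<Rightarrow> complex mat) \<Rightarrow> ('d \<Rightarrow> complex mat) \<Rightarrow> 'd \<Rightarrow> complex mat" where
  "tuple_direct_sum X Y = (\<lambda>i. diag_block_mat [X i, Y i])"

definition matrix_convex :: "(nat \<Rightarrow> ('d::finite \<Rightarrow> complex mat) set) \<Rightarrow> bool" where
  "matrix_convex S \<longleftrightarrow>
     (\<forall>n\<ge>1. S n \<subseteq> sa_tuples n) \<and>
     (\<forall>m\<ge>1. \<forall>n\<ge>1. \<forall>X\<in>S m. \<forall>Y\<in>S n. tuple_direct_sum X Y \<in> S (m + n)) \<and>
     (\<forall>n\<ge>1. \<forall>k\<ge>1. \<forall>X\<in>S n. \<forall>\<phi>. ucp n k \<phi> \<longrightarrow> (\<lambda>i. \<phi> (X i)) \<in> S k)"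

text \<open>The first level as a subset of \<open>\<real>\<^sup>d\<close>: self-adjoint \<open>1 \<times> 1\<close> matrices are real scalars.\<close>

definition first_level :: "(nat \<Rightarrow> ('d::finite \<Rightarrow> complex mat) set) \<Rightarrow> (real ^ 'd) set" where
  "first_level S =
     {x. (\<lambda>i. Matrix.mat 1 1 (\<lambda>_. complex_of_real (x $ i))) \<in> S 1}"

definition scale_levels ::
    "real \<Rightarrow> (nat \<Rightarrow> ('d::finite \<Rightarrow> complex mat) set) \<Rightarrow> nat \<Rightarrow> ('d \<Rightarrow> complex mat) set" where
  "scale_levels C T n = (\<lambda>X i. complex_of_real C \<cdot>\<^sub>m X i) ` T n"

definition levels_subset ::
    "(nat \<Rightarrow> ('d::finite \<Rightarrow> complex mat) set) \<Rightarrow> (nat \<Rightarrow> ('d \<Rightarrow> complex mat) set) \<Rightarrow> bool" where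
  "levels_subset S T \<longleftrightarrow> (\<forall>n\<ge>1. S n \<subseteq> T n)"

end

theory Submission
  imports Defs "Jordan_Normal_Form.Spectral_Radius"
begin

text \<open>
  If \<open>\<lambda> = u v\<^sup>T\<close> and \<open>X \<in> S\<^sub>n\<close>, then \<open>\<lambda>X = (u\<^sub>1 H, \<dots>, u\<^sub>d H)\<close> for the single self-adjoint matrix
  \<open>H = \<Sum>\<^sub>j v\<^sub>j X\<^sub>j\<close>, so \<open>\<lambda>X\<close> is simultaneously diagonalisable. Its joint eigenvalues have the form
  \<open>\<lambda>x\<close> with \<open>x = (\<langle>X\<^sub>j e, e\<rangle>)\<^sub>j\<close> for a unit vector \<open>e\<close>; such \<open>x\<close> lies in \<open>S\<^sub>1\<close>, because compression
  to \<open>e\<close> is UCP, hence \<open>\<lambda>x \<in> C S\<^sub>1 \<subseteq> C T\<^sub>1\<close>. Direct sums and unitary conjugation put \<open>\<lambda>X\<close> into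
  \<open>C T\<^sub>n\<close>, which is convex, and averaging over the \<open>\<lambda>\<^sup>(\<^sup>m\<^sup>)\<close> gives \<open>X \<in> C T\<^sub>n\<close>. Every UCP map
  that is needed has the form \<open>A \<mapsto> V\<^sup>* A V\<close> with \<open>V\<close> an isometry.
\<close>

section \<open>Adjoints and quadratic forms\<close>

lemma mat_adjoint_carrier [simp]:
  "A \<in> carrier_mat n k \<Longrightarrow> mat_adjoint A \<in> carrier_mat k n"
  by (auto simp: mat_adjoint_def)

lemma dim_mat_adjoint [simp]:
  "dim_row (mat_adjoint A) = dim_col A" "dim_col (mat_adjoint A) = dim_row A"
  by (auto simp: mat_adjoint_def)

lemma index_mat_adjoint [simp]:
  fixes A :: "complex mat"
  assumes "i < dim_col A" "j < dim_row A"
  shows "mat_adjoint A $$ (i, j) = cnj (A $$ (j, i))"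
  using assms by (simp add: mat_adjoint_def mat_of_rows_def)

lemma mat_adjoint_adjoint [simp]: "mat_adjoint (mat_adjoint A) = (A :: complex mat)"
  by (rule eq_matI) auto

lemma mat_adjoint_mult:
  fixes A B :: "complex mat"
  assumes "A \<in> carrier_mat n k" "B \<in> carrier_mat k l"
  shows "mat_adjoint (A * B) = mat_adjoint B * mat_adjoint A"
  using assms by (intro eq_matI) (auto simp: scalar_prod_def mult.commute)

text \<open>In coordinates, identities between quadratic forms become reorderings of finite sums;
  this is how forms are compared below.\<close>

lemma cscalar_prod_mult_mat_vec:
  fixes A :: "complex mat"
  assumes "A \<in> carrier_mat n k" "v \<in> carrier_vec k" "w \<in> carrier_vec n"
  shows "(A *\<^sub>v v) \<bullet>c w = (\<Sum>p<n. \<Sum>q<k. A $$ (p, q) * Matrix.vec_index v q * cnj (Matrix.vec_index w p))"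
  using assms
  by (auto simp: scalar_prod_def sum_distrib_right lessThan_atLeast0 intro!: sum.cong)

lemma cscalar_prod_adjoint:
  fixes A :: "complex mat"
  assumes "A \<in> carrier_mat n k" "v \<in> carrier_vec k" "w \<in> carrier_vec n"
  shows "(A *\<^sub>v v) \<bullet>c w = v \<bullet>c (mat_adjoint A *\<^sub>v w)"
proof -
  have "(A *\<^sub>v v) \<bullet>c w = (\<Sum>q<k. \<Sum>p<n. A $$ (p, q) * Matrix.vec_index v q * cnj (Matrix.vec_index w p))"
    unfolding cscalar_prod_mult_mat_vec[OF assms] by (rule sum.swap)
  also have "\<dots> = v \<bullet>c (mat_adjoint A *\<^sub>v w)"
    using assms
    by (auto simp: scalar_prod_def sum_distrib_left lessThan_atLeast0 mult_ac intro!: sum.cong)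
  finally show ?thesis .
qed

lemma cscalar_prod_congruence:
  fixes A V :: "complex mat"
  assumes "A \<in> carrier_mat n n" "V \<in> carrier_mat n k" "v \<in> carrier_vec k"
  shows "((mat_adjoint V * A * V) *\<^sub>v v) \<bullet>c v = (A *\<^sub>v (V *\<^sub>v v)) \<bullet>c (V *\<^sub>v v)"
proof -
  have V': "mat_adjoint V \<in> carrier_mat k n" and AV: "A *\<^sub>v (V *\<^sub>v v) \<in> carrier_vec n"
    using assms by auto
  have "(mat_adjoint V * A * V) *\<^sub>v v = mat_adjoint V *\<^sub>v (A *\<^sub>v (V *\<^sub>v v))"
    using assms V' mult_carrier_mat[OF V' assms(1)]
    by (simp add: assoc_mult_mat_vec[of "mat_adjoint V * A" k n V k]
        assoc_mult_mat_vec[of "mat_adjoint V" k n A n])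
  then show ?thesis
    using cscalar_prod_adjoint[OF V' AV assms(3)] by simp
qed

section \<open>Isometric compressions\<close>

text \<open>The substitution p = i * n + r is the indexing of \<open>block\<close> and
  \<open>ampliation\<close>, so sums over the indices of an ampliated matrix become sums over
  blocks.\<close>

lemma sum_blocks:
  fixes f :: "nat \<Rightarrow> 'a::comm_monoid_add"
  shows "(\<Sum>p<m * n. f p) = (\<Sum>i<m. \<Sum>r<n. f (i * n + r))"
proof -
  have "(\<Sum>p<m * n. f p) = (\<Sum>i<m. sum f {i * n..<i * n + n})"
    by (rule sum.nat_group[symmetric])
  also have "\<dots> = (\<Sum>i<m. \<Sum>r<n. f (i * n + r))"
  proof (rule sum.cong[OF refl])
    fix i
    show "sum f {i * n..<i * n + n} = (\<Sum>r<n. f (i * n + r))"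
      using sum.shift_bounds_nat_ivl[of f 0 "i * n" n]
      by (simp add: lessThan_atLeast0 add.commute)
  qed
  finally show ?thesis .
qed

lemma block_index_less:
  fixes i m n r :: nat
  assumes "i < m" "r < n"
  shows "i * n + r < m * n"
proof -
  have "i * n + r < Suc i * n" using assms by simp
  also have "\<dots> \<le> m * n" using assms by (intro mult_le_mono1) simp
  finally show ?thesis .
qed

lemma congruence_index:
  fixes A V :: "complex mat"
  assumes "A \<in> carrier_mat n n" "V \<in> carrier_mat n k" "a < k" "b < k"
  shows "(mat_adjoint V * A * V) $$ (a, b) =
    (\<Sum>s<n. \<Sum>r<n. cnj (V $$ (r, a)) * A $$ (r, s) * V $$ (s, b))"
  using assms by (auto simp: scalar_prod_def sum_distrib_right lessThan_atLeast0 intro!: sum.cong)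

lemma linear_congruence:
  assumes "V \<in> carrier_mat n k"
  shows "linear_mat_map n k (\<lambda>A. mat_adjoint V * A * V)"
proof -
  have V': "mat_adjoint V \<in> carrier_mat k n" using assms by simp
  show ?thesis
    unfolding linear_mat_map_def
  proof (intro conjI ballI allI)
    fix A B :: "complex mat" and c :: complex
    assume A: "A \<in> carrier_mat n n"
    show "mat_adjoint V * A * V \<in> carrier_mat k k"
      using A V' assms by auto
    show "mat_adjoint V * (c \<cdot>\<^sub>m A) * V = c \<cdot>\<^sub>m (mat_adjoint V * A * V)"
      using A V' assms mult_carrier_mat[OF V' A]
      by (simp add: mult_smult_distrib[OF V' A] mult_smult_assoc_mat[of "mat_adjoint V * A" k n V k])
    assume B: "B \<in> carrier_mat n n"
    show "mat_adjoint V * (A + B) * V = mat_adjoint V * A * V + mat_adjoint V * B * V"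
      using A B V' assms
      by (simp add: mult_add_distrib_mat[OF V' A B]
          add_mult_distrib_mat[OF mult_carrier_mat[OF V' A] mult_carrier_mat[OF V' B] assms])
  qed
qed

text \<open>The ampliation of A \<mapsto> V* A V is congruence by the tensor product of I_m and V.
  Its quadratic form at w is therefore that of A at the vector obtained by applying V to each block
  of w.\<close>

lemma completely_positive_congruence:
  assumes V: "V \<in> carrier_mat n k"
  shows "completely_positive n k (\<lambda>A. mat_adjoint V * A * V)"
  unfolding completely_positive_def
proof (intro conjI allI impI)
  show "linear_mat_map n k (\<lambda>A. mat_adjoint V * A * V)"
    by (rule linear_congruence[OF V])
  fix m :: nat and A
  assume "1 \<le> m" and psd: "psd (m * n) A"
  let ?\<phi> = "\<lambda>A. mat_adjoint V * A * V"
  let ?B = "ampliation m n k ?\<phi> A"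
  have A: "A \<in> carrier_mat (m * n) (m * n)" using psd by (simp add: psd_def)
  have Bc: "?B \<in> carrier_mat (m * k) (m * k)" by (simp add: ampliation_def)
  have Bi: "?B $$ (i * k + a, j * k + b) =
      (\<Sum>s<n. \<Sum>r<n. cnj (V $$ (r, a)) * A $$ (i * n + r, j * n + s) * V $$ (s, b))"
    if "i < m" "j < m" "a < k" "b < k" for i j a b
  proof -
    have bl: "block n A i j \<in> carrier_mat n n" by (simp add: block_def)
    have "?B $$ (i * k + a, j * k + b) = ?\<phi> (block n A i j) $$ (a, b)"
      using that block_index_less[of i m a k] block_index_less[of j m b k]
      by (simp add: ampliation_def)
    also have "\<dots> = (\<Sum>s<n. \<Sum>r<n. cnj (V $$ (r, a)) * block n A i j $$ (r, s) * V $$ (s, b))"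
      by (rule congruence_index[OF bl V that(3,4)])
    finally show ?thesis by (simp add: block_def)
  qed
  show "psd (m * k) ?B"
    unfolding psd_def
  proof (intro conjI ballI Bc)
    fix w :: "complex Matrix.vec"
    assume w: "w \<in> carrier_vec (m * k)"
    define W where "W i a = Matrix.vec_index w (i * k + a)" for i a
    \<comment> \<open>The image of w under the tensor product of I_m and V: block i of z is V
      applied to the block \<open>W i\<close> of w.\<close>
    define z where "z = Matrix.vec (m * n)
      (\<lambda>p. \<Sum>b<k. V $$ (p mod n, b) * W (p div n) b)"
    have z: "z \<in> carrier_vec (m * n)" by (simp add: z_def)
    have zi: "Matrix.vec_index z (i * n + r) = (\<Sum>b<k. V $$ (r, b) * W i b)"
      if "i < m" "r < n" for i r
      using that block_index_less[OF that] by (simp add: z_def)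
    \<comment> \<open>The contribution of one pair of blocks: f stands for a block of A, and y and x
      for blocks of w. Moving the sums over b and a innermost exhibits the vectors V y and V
      x.\<close>
    have inner: "(\<Sum>a<k. \<Sum>b<k. (\<Sum>s<n. \<Sum>r<n. cnj (V $$ (r, a)) * f r s * V $$ (s, b)) * y b * cnj (x a))
        = (\<Sum>r<n. \<Sum>s<n. f r s * (\<Sum>b<k. V $$ (s, b) * y b) * cnj (\<Sum>a<k. V $$ (r, a) * x a))"
      for f :: "nat \<Rightarrow> nat \<Rightarrow> complex" and x y
    proof -
      have "(\<Sum>a<k. \<Sum>b<k. (\<Sum>s<n. \<Sum>r<n. cnj (V $$ (r, a)) * f r s * V $$ (s, b)) * y b * cnj (x a))
        = (\<Sum>a<k. \<Sum>b<k. \<Sum>s<n. \<Sum>r<n. f r s * (V $$ (s, b) * y b) * cnj (V $$ (r, a) * x a))"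
        unfolding sum_distrib_right by (intro sum.cong refl) (simp add: mult_ac)
      also have "\<dots> = (\<Sum>a<k. \<Sum>s<n. \<Sum>b<k. \<Sum>r<n. f r s * (V $$ (s, b) * y b) * cnj (V $$ (r, a) * x a))"
        by (intro sum.cong refl sum.swap)
      also have "\<dots> = (\<Sum>a<k. \<Sum>s<n. \<Sum>r<n. \<Sum>b<k. f r s * (V $$ (s, b) * y b) * cnj (V $$ (r, a) * x a))"
        by (intro sum.cong refl sum.swap)
      also have "\<dots> = (\<Sum>s<n. \<Sum>a<k. \<Sum>r<n. \<Sum>b<k. f r s * (V $$ (s, b) * y b) * cnj (V $$ (r, a) * x a))"
        by (rule sum.swap)
      also have "\<dots> = (\<Sum>s<n. \<Sum>r<n. \<Sum>a<k. \<Sum>b<k. f r s * (V $$ (s, b) * y b) * cnj (V $$ (r, a) * x a))"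
        by (intro sum.cong refl sum.swap)
      also have "\<dots> = (\<Sum>r<n. \<Sum>s<n. \<Sum>a<k. \<Sum>b<k. f r s * (V $$ (s, b) * y b) * cnj (V $$ (r, a) * x a))"
        by (rule sum.swap)
      also have "\<dots> = (\<Sum>r<n. \<Sum>s<n. f r s * (\<Sum>b<k. V $$ (s, b) * y b) * cnj (\<Sum>a<k. V $$ (r, a) * x a))"
        by (simp add: sum_distrib_right sum_distrib_left)
      finally show ?thesis .
    qed
    have "(?B *\<^sub>v w) \<bullet>c w =
        (\<Sum>p<m * k. \<Sum>q<m * k. ?B $$ (p, q) * Matrix.vec_index w q * cnj (Matrix.vec_index w p))"
      by (rule cscalar_prod_mult_mat_vec[OF Bc w w])
    also have "\<dots> = (\<Sum>i<m. \<Sum>a<k. \<Sum>j<m. \<Sum>b<k. ?B $$ (i * k + a, j * k + b) * W j b * cnj (W i a))"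
      by (simp add: sum_blocks W_def)
    also have "\<dots> = (\<Sum>i<m. \<Sum>j<m. \<Sum>a<k. \<Sum>b<k. ?B $$ (i * k + a, j * k + b) * W j b * cnj (W i a))"
      by (intro sum.cong refl sum.swap)
    also have "\<dots> = (\<Sum>i<m. \<Sum>j<m. \<Sum>a<k. \<Sum>b<k.
        (\<Sum>s<n. \<Sum>r<n. cnj (V $$ (r, a)) * A $$ (i * n + r, j * n + s) * V $$ (s, b)) * W j b * cnj (W i a))"
      using Bi by (intro sum.cong refl) simp
    also have "\<dots> = (\<Sum>i<m. \<Sum>j<m. \<Sum>r<n. \<Sum>s<n. A $$ (i * n + r, j * n + s) *
        (\<Sum>b<k. V $$ (s, b) * W j b) * cnj (\<Sum>a<k. V $$ (r, a) * W i a))"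
      by (intro sum.cong refl inner)
    also have "\<dots> = (\<Sum>i<m. \<Sum>j<m. \<Sum>r<n. \<Sum>s<n. A $$ (i * n + r, j * n + s) *
        Matrix.vec_index z (j * n + s) * cnj (Matrix.vec_index z (i * n + r)))"
      by (intro sum.cong refl) (simp add: zi)
    \<comment> \<open>This order puts i next to r and j next to s, so that each pair merges into a
      single index of A.\<close>
    also have "\<dots> = (\<Sum>i<m. \<Sum>r<n. \<Sum>j<m. \<Sum>s<n. A $$ (i * n + r, j * n + s) *
        Matrix.vec_index z (j * n + s) * cnj (Matrix.vec_index z (i * n + r)))"
      by (intro sum.cong refl sum.swap)
    also have "\<dots> = (\<Sum>p<m * n. \<Sum>q<m * n. A $$ (p, q) * Matrix.vec_index z q * cnj (Matrix.vec_index z p))"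
      by (simp add: sum_blocks)
    also have "\<dots> = (A *\<^sub>v z) \<bullet>c z"
      by (rule cscalar_prod_mult_mat_vec[OF A z z, symmetric])
    finally show "0 \<le> (?B *\<^sub>v w) \<bullet>c w"
      using psd z by (simp add: psd_def)
  qed
qed

text \<open>Compression by V is unital exactly when V is an isometry. It is used below in three
  forms: averaging a direct sum, compressing to a unit vector, and conjugating by a unitary.\<close>

lemma matrix_convex_isometry:
  assumes "matrix_convex S" "1 \<le> n" "1 \<le> k" "X \<in> S n"
    and V: "V \<in> carrier_mat n k" "mat_adjoint V * V = 1\<^sub>m k"
  shows "(\<lambda>i. mat_adjoint V * X i * V) \<in> S k"
proof -
  have "mat_adjoint V * 1\<^sub>m n * V = 1\<^sub>m k"
    using V by (simp add: right_mult_one_mat[of _ k n])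
  then have "ucp n k (\<lambda>A. mat_adjoint V * A * V)"
    using completely_positive_congruence[OF V(1)] by (simp add: ucp_def)
  with assms show ?thesis
    unfolding matrix_convex_def by blast
qed

section \<open>Convexity of the levels\<close>

lemma tuple_direct_sum_index:
  assumes "X i \<in> carrier_mat m m" "Y i \<in> carrier_mat n n" "r < m + n" "c < m + n"
  shows "tuple_direct_sum X Y i $$ (r, c) =
    (if r < m then if c < m then X i $$ (r, c) else 0
     else if c < m then 0 else Y i $$ (r - m, c - m))"
  using assms by (auto simp: tuple_direct_sum_def Let_def)

text \<open>An average is a compression of the direct sum of X and Y, by the matrix V with the
  blocks sqrt a I and sqrt b I stacked. Here V* V = (a + b) I = I.\<close>

lemma matrix_convex_convex_comb:
  assumes S: "matrix_convex S" and n: "1 \<le> n" and X: "X \<in> S n" and Y: "Y \<in> S n"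
    and ab: "0 \<le> a" "0 \<le> b" "a + b = (1::real)"
  shows "(\<lambda>i. complex_of_real a \<cdot>\<^sub>m X i + complex_of_real b \<cdot>\<^sub>m Y i) \<in> S n"
proof -
  define V where "V = Matrix.mat (n + n) n (\<lambda>(r, c). if r = c then complex_of_real (sqrt a)
    else if r = n + c then complex_of_real (sqrt b) else 0)"
  have V: "V \<in> carrier_mat (n + n) n" by (simp add: V_def)
  let ?Z = "tuple_direct_sum X Y"
  have Z: "?Z \<in> S (n + n)"
    using S n X Y by (simp add: matrix_convex_def)
  have Xc: "X i \<in> carrier_mat n n" and Yc: "Y i \<in> carrier_mat n n" for i
    using S n X Y unfolding matrix_convex_def sa_tuples_def by blast+
  have Zc: "?Z i \<in> carrier_mat (n + n) (n + n)" for i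
    using Xc[of i] Yc[of i] by (auto simp: tuple_direct_sum_def Let_def)
  have sq: "complex_of_real (sqrt a) * complex_of_real (sqrt a) = of_real a"
    "complex_of_real (sqrt b) * complex_of_real (sqrt b) = of_real b"
    using ab by (simp_all flip: of_real_mult)
  \<comment> \<open>Column c of V can be nonzero only in the rows c and n + c, so a sum against it
    has two terms.\<close>
  have half: "(\<Sum>r<n + n. cnj (V $$ (r, c)) * f r) =
      of_real (sqrt a) * f c + of_real (sqrt b) * f (n + c)"
    if "c < n" for f c
  proof -
    have "(\<Sum>r<n + n. cnj (V $$ (r, c)) * f r) = (\<Sum>r\<in>{c, n + c}. cnj (V $$ (r, c)) * f r)"
      using that by (intro sum.mono_neutral_right) (auto simp: V_def)
    with that show ?thesis by (simp add: V_def)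
  qed
  have half': "(\<Sum>r<n + n. f r * V $$ (r, c)) =
      of_real (sqrt a) * f c + of_real (sqrt b) * f (n + c)"
    if "c < n" for f c
  proof -
    have "(\<Sum>r<n + n. f r * V $$ (r, c)) = (\<Sum>r\<in>{c, n + c}. f r * V $$ (r, c))"
      using that by (intro sum.mono_neutral_right) (auto simp: V_def)
    with that show ?thesis by (simp add: V_def)
  qed
  have "mat_adjoint V * V = 1\<^sub>m n"
  proof (rule eq_matI)
    fix r c assume rc: "r < dim_row (1\<^sub>m n :: complex mat)" "c < dim_col (1\<^sub>m n :: complex mat)"
    then have "(mat_adjoint V * V) $$ (r, c) = (\<Sum>s<n + n. cnj (V $$ (s, r)) * V $$ (s, c))"
      using V by (simp add: scalar_prod_def lessThan_atLeast0)
    also have "\<dots> = 1\<^sub>m n $$ (r, c)"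
      using rc ab sq by (subst half) (auto simp: V_def simp flip: of_real_add)
    finally show "(mat_adjoint V * V) $$ (r, c) = 1\<^sub>m n $$ (r, c)" .
  qed (use V in auto)
  then have "(\<lambda>i. mat_adjoint V * ?Z i * V) \<in> S n"
    using matrix_convex_isometry[OF S _ n Z V] n by simp
  moreover have "mat_adjoint V * ?Z i * V = of_real a \<cdot>\<^sub>m X i + of_real b \<cdot>\<^sub>m Y i" for i
  proof (rule eq_matI)
    fix r c assume "r < dim_row (complex_of_real a \<cdot>\<^sub>m X i + of_real b \<cdot>\<^sub>m Y i)"
      "c < dim_col (complex_of_real a \<cdot>\<^sub>m X i + of_real b \<cdot>\<^sub>m Y i)"
    then have rc: "r < n" "c < n" using Yc[of i] by auto
    have "(mat_adjoint V * ?Z i * V) $$ (r, c) =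
        (\<Sum>s<n + n. (\<Sum>t<n + n. cnj (V $$ (t, r)) * ?Z i $$ (t, s)) * V $$ (s, c))"
      by (simp add: congruence_index[OF Zc V rc] sum_distrib_right)
    \<comment> \<open>Four terms remain, of which the two from the off-diagonal blocks of the direct
      sum vanish.\<close>
    also have "\<dots> = of_real a * X i $$ (r, c) + of_real b * Y i $$ (r, c)"
      using rc sq
      by (simp add: half half' tuple_direct_sum_index[OF Xc Yc] flip: mult.assoc)
    finally show "(mat_adjoint V * ?Z i * V) $$ (r, c) = (of_real a \<cdot>\<^sub>m X i + of_real b \<cdot>\<^sub>m Y i) $$ (r, c)"
      using rc Xc[of i] Yc[of i] by simp
  qed (use V Xc[of i] Yc[of i] in auto)
  ultimately show ?thesis by simp
qed

section \<open>Diagonalisation inside a matrix convex set\<close>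

text \<open>Gram-Schmidt is applied to a basis starting with e and the result is normalised. Neither
  operation changes e, which comes first and has unit length. With e an eigenvector, U splits off
  one eigenvalue in the induction below.\<close>

lemma unitary_with_first_col:
  assumes e: "e \<in> carrier_vec n" "e \<bullet>c e = (1::complex)" and n: "0 < n"
  obtains U where "U \<in> carrier_mat n n" "mat_adjoint U * U = 1\<^sub>m n" "Matrix.col U 0 = e"
proof -
  interpret cof_vec_space n "TYPE(complex)" .
  have "e \<noteq> 0\<^sub>v n" using e by auto
  note bc = basis_completion[OF e(1) this]
  define ws where "ws = gram_schmidt n (basis_completion e)"
  note gs = gram_schmidt_result[OF bc(2,4,5) ws_def]
  have len: "length ws = n" using gs(4) bc(6) by simp
  have ws: "ws ! i \<in> carrier_vec n" if "i < n" for i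
    using gs(3) len that by (auto dest: nth_mem)
  have "basis_completion e = e # tl (basis_completion e)"
    using bc(6,7) n by (cases "basis_completion e") auto
  then have "hd ws = e"
    using gram_schmidt_hd[OF e(1), of "tl (basis_completion e)"] by (simp add: ws_def)
  then have ws0: "ws ! 0 = e"
    using len n by (cases ws) auto
  define N where "N i = sqrt (Re (ws ! i \<bullet>c ws ! i))" for i
  have N: "ws ! i \<bullet>c ws ! i = of_real (N i) * of_real (N i)" "N i \<noteq> 0" if "i < n" for i
  proof -
    have "0 \<le> ws ! i \<bullet>c ws ! i" by (rule conjugate_square_ge_0_vec)
    moreover have "ws ! i \<bullet>c ws ! i \<noteq> 0"
      using corthogonalD[OF gs(2), of i i] that len by simp
    ultimately show "ws ! i \<bullet>c ws ! i = of_real (N i) * of_real (N i)" "N i \<noteq> 0"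
      by (auto simp: N_def less_eq_complex_def complex_eq_iff simp flip: of_real_mult)
  qed
  have N0: "N 0 = 1" by (simp add: N_def ws0 e)
  define U where "U = Matrix.mat n n (\<lambda>(r, c). Matrix.vec_index (ws ! c) r / of_real (N c))"
  have U: "U \<in> carrier_mat n n" by (simp add: U_def)
  have "mat_adjoint U * U = 1\<^sub>m n"
  proof (rule eq_matI)
    fix i j assume "i < dim_row (1\<^sub>m n :: complex mat)" "j < dim_col (1\<^sub>m n :: complex mat)"
    then have ij: "i < n" "j < n" by auto
    have "(mat_adjoint U * U) $$ (i, j) = (ws ! j \<bullet>c ws ! i) / (of_real (N i) * of_real (N j))"
      using ij ws[OF ij(1)] ws[OF ij(2)]
      by (simp add: U_def scalar_prod_def sum_divide_distrib mult_ac)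
    also have "\<dots> = 1\<^sub>m n $$ (i, j)"
      using corthogonalD[OF gs(2), of j i] ij N len by auto
    finally show "(mat_adjoint U * U) $$ (i, j) = 1\<^sub>m n $$ (i, j)" .
  qed (use U in auto)
  moreover have "Matrix.col U 0 = e"
    using n e by (auto simp: U_def N0 ws0)
  ultimately show thesis
    using that U by blast
qed

lemma unit_eigenvector_exists:
  fixes H :: "complex mat"
  assumes H: "H \<in> carrier_mat n n" and n: "0 < n"
  obtains e \<mu> where "e \<in> carrier_vec n" "e \<bullet>c e = 1" "H *\<^sub>v e = \<mu> \<cdot>\<^sub>v e"
proof -
  obtain v \<mu> where v: "v \<in> carrier_vec n" "v \<noteq> 0\<^sub>v n" "H *\<^sub>v v = \<mu> \<cdot>\<^sub>v v"
    using spectrum_non_empty[OF H n] H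
    by (auto simp: spectrum_def eigenvalue_def eigenvector_def)
  define N where "N = sqrt (Re (v \<bullet>c v))"
  have "0 \<le> v \<bullet>c v" by (rule conjugate_square_ge_0_vec)
  then have N: "v \<bullet>c v = of_real N * of_real N" "N \<noteq> 0"
    using v conjugate_square_eq_0_vec[OF v(1)]
    by (auto simp: N_def less_eq_complex_def complex_eq_iff simp flip: of_real_mult)
  define e where "e = complex_of_real (1 / N) \<cdot>\<^sub>v v"
  have "e \<in> carrier_vec n" using v by (simp add: e_def)
  moreover have "e \<bullet>c e = 1"
    using v N by (simp add: e_def conjugate_smult_vec)
  moreover have "H *\<^sub>v e = \<mu> \<cdot>\<^sub>v e"
    using v H by (simp add: e_def mult_mat_vec smult_smult_assoc mult.commute)
  ultimately show thesis using that by blast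
qed

text \<open>The hypothesis is phrased through the numerical range of \<open>H\<close> rather than its eigenvalues
  because the numerical range shrinks under compressions, which is what the induction needs.\<close>

lemma rank_one_tuple_mem:
  fixes T :: "nat \<Rightarrow> ('d::finite \<Rightarrow> complex mat) set" and u :: "'d \<Rightarrow> complex"
  assumes T: "matrix_convex T" and n: "1 \<le> n"
    and H: "H \<in> carrier_mat n n" "mat_adjoint H = H"
    and range: "\<And>e. e \<in> carrier_vec n \<Longrightarrow> e \<bullet>c e = 1 \<Longrightarrow>
      (\<lambda>i. Matrix.mat 1 1 (\<lambda>_. u i * ((H *\<^sub>v e) \<bullet>c e))) \<in> T 1"
  shows "(\<lambda>i. u i \<cdot>\<^sub>m H) \<in> T n"
  using n H range
proof (induction n arbitrary: H rule: dec_induct)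
  case base
  \<comment> \<open>A 1 x 1 matrix is its own value at this unit vector, so the hypothesis on the
    numerical range is already the claim.\<close>
  define e :: "complex Matrix.vec" where "e = unit_vec 1 0"
  have "e \<in> carrier_vec 1" "e \<bullet>c e = 1" by (auto simp: e_def scalar_prod_def)
  moreover have "Matrix.mat 1 1 (\<lambda>_. u i * ((H *\<^sub>v e) \<bullet>c e)) = u i \<cdot>\<^sub>m H" for i
    using base.prems(1) by (intro eq_matI) (auto simp: e_def scalar_prod_def)
  ultimately show ?case using base.prems(3)[of e] by simp
next
  case (step m)
  note H = step.prems(1) and range = step.prems(3)
  obtain e \<mu> where e: "e \<in> carrier_vec (Suc m)" "e \<bullet>c e = 1" "H *\<^sub>v e = \<mu> \<cdot>\<^sub>v e"
    using unit_eigenvector_exists[OF H] by blast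
  obtain U where U: "U \<in> carrier_mat (Suc m) (Suc m)" "mat_adjoint U * U = 1\<^sub>m (Suc m)"
      "Matrix.col U 0 = e"
    using unitary_with_first_col[OF e(1,2)] by blast
  let ?U = "mat_adjoint U"
  have U': "?U \<in> carrier_mat (Suc m) (Suc m)" using U by simp
  have UU: "U * ?U = 1\<^sub>m (Suc m)"
    by (rule mat_mult_left_right_inverse[OF U' U(1,2)])
  \<comment> \<open>In a basis starting with the eigenvector e, H becomes the direct sum of the
    scalar \<mu> and a self-adjoint matrix H' of size m. The first column of B is U* H e = \<mu> U*
    e, and U* e is the first unit vector.\<close>
  define B where "B = ?U * H * U"
  have B: "B \<in> carrier_mat (Suc m) (Suc m)" using U U' H by (auto simp: B_def)
  have Bsa: "mat_adjoint B = B"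
  proof -
    have "mat_adjoint B = ?U * mat_adjoint (?U * H)"
      unfolding B_def by (rule mat_adjoint_mult[OF _ U(1)]) (use U' H in auto)
    also have "mat_adjoint (?U * H) = H * U"
      using mat_adjoint_mult[OF U' H] step.prems(2) by simp
    finally show ?thesis
      unfolding B_def by (simp only: assoc_mult_mat[OF U' H U(1)])
  qed
  have Bcol: "Matrix.col B 0 = \<mu> \<cdot>\<^sub>v unit_vec (Suc m) 0"
  proof -
    have "B = ?U * (H * U)" unfolding B_def by (rule assoc_mult_mat[OF U' H U(1)])
    then have "Matrix.col B 0 = ?U *\<^sub>v (H *\<^sub>v e)"
      using col_mult2[OF U' mult_carrier_mat[OF H U(1)], of 0] col_mult2[OF H U(1), of 0] U(3) by simp
    also have "\<dots> = \<mu> \<cdot>\<^sub>v (?U *\<^sub>v Matrix.col U 0)"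
      using mult_mat_vec[OF U' e(1), of \<mu>] U(3) e(3) by simp
    also have "?U *\<^sub>v Matrix.col U 0 = Matrix.col (1\<^sub>m (Suc m)) 0"
      using col_mult2[OF U' U(1), of 0] U(2) by simp
    finally show ?thesis by simp
  qed
  have Bc0: "B $$ (r, 0) = (if r = 0 then \<mu> else 0)" if "r < Suc m" for r
    using arg_cong[OF Bcol, of "\<lambda>v. Matrix.vec_index v r"] B that by simp
  \<comment> \<open>Self-adjointness turns the zeros of the first column into zeros of the first
    row.\<close>
  have Br0: "B $$ (0, r) = 0" if "r < Suc m" "r \<noteq> 0" for r
    using arg_cong[OF Bsa, of "\<lambda>M. M $$ (0, r)"] B that Bc0[OF that(1)] by simp
  define H' where "H' = Matrix.mat m m (\<lambda>(r, c). B $$ (Suc r, Suc c))"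
  have H': "H' \<in> carrier_mat m m" by (simp add: H'_def)
  have H'sa: "mat_adjoint H' = H'"
  proof (rule eq_matI)
    fix r c assume rc: "r < dim_row H'" "c < dim_col H'"
    then have "cnj (B $$ (Suc c, Suc r)) = B $$ (Suc r, Suc c)"
      using arg_cong[OF Bsa, of "\<lambda>M. M $$ (Suc r, Suc c)"] B by (simp add: H'_def)
    with rc show "mat_adjoint H' $$ (r, c) = H' $$ (r, c)" by (simp add: H'_def)
  qed (simp_all add: H'_def)
  have "(\<lambda>i. Matrix.mat 1 1 (\<lambda>_. u i * ((H' *\<^sub>v f) \<bullet>c f))) \<in> T 1"
    if f: "f \<in> carrier_vec m" "f \<bullet>c f = 1" for f
  proof -
    \<comment> \<open>The value of H' at f equals that of H at U (0, f), again a unit vector, so the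
      hypothesis \<open>range\<close> passes from H to H'.\<close>
    let ?g = "vCons 0 f"
    have g: "?g \<in> carrier_vec (Suc m)" using f by simp
    have "(B *\<^sub>v ?g) \<bullet>c ?g =
        (\<Sum>p<Suc m. \<Sum>q<Suc m. B $$ (p, q) * Matrix.vec_index ?g q * cnj (Matrix.vec_index ?g p))"
      by (rule cscalar_prod_mult_mat_vec[OF B g g])
    also have "\<dots> = (\<Sum>p<m. \<Sum>q<m. H' $$ (p, q) * Matrix.vec_index f q * cnj (Matrix.vec_index f p))"
      by (simp add: sum.lessThan_Suc_shift H'_def del: sum.lessThan_Suc)
    also have "\<dots> = (H' *\<^sub>v f) \<bullet>c f"
      by (rule cscalar_prod_mult_mat_vec[OF H' f(1) f(1), symmetric])
    finally have "(H *\<^sub>v (U *\<^sub>v ?g)) \<bullet>c (U *\<^sub>v ?g) = (H' *\<^sub>v f) \<bullet>c f"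
      using cscalar_prod_congruence[OF H U(1) g] by (simp add: B_def)
    moreover have "(U *\<^sub>v ?g) \<bullet>c (U *\<^sub>v ?g) = 1"
    proof -
      have "(U *\<^sub>v ?g) \<bullet>c (U *\<^sub>v ?g) = ?g \<bullet>c (?U *\<^sub>v (U *\<^sub>v ?g))"
        using U g by (intro cscalar_prod_adjoint) auto
      also have "?U *\<^sub>v (U *\<^sub>v ?g) = ?g"
        using assoc_mult_mat_vec[OF U' U(1) g] U(2) g by simp
      finally show ?thesis using f by simp
    qed
    ultimately show ?thesis
      using range[of "U *\<^sub>v ?g"] U(1) g by simp
  qed
  then have lower: "(\<lambda>i. u i \<cdot>\<^sub>m H') \<in> T m"
    by (rule step.IH[OF H' H'sa])
  \<comment> \<open>The eigenvalue itself is the value of H at e, so \<open>range\<close> also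
    supplies the scalar summand.\<close>
  have "(H *\<^sub>v e) \<bullet>c e = \<mu>" using e by simp
  then have upper: "(\<lambda>i. Matrix.mat 1 1 (\<lambda>_. u i * \<mu>)) \<in> T 1"
    using range[OF e(1,2)] by simp
  let ?D = "tuple_direct_sum (\<lambda>i. Matrix.mat 1 1 (\<lambda>_. u i * \<mu>)) (\<lambda>i. u i \<cdot>\<^sub>m H')"
  have "?D \<in> T (1 + m)"
    using T step.hyps upper lower unfolding matrix_convex_def by blast
  moreover have "?D = (\<lambda>i. u i \<cdot>\<^sub>m B)"
  proof
    fix i
    show "?D i = u i \<cdot>\<^sub>m B"
    proof (rule eq_matI)
      fix r c assume "r < dim_row (u i \<cdot>\<^sub>m B)" "c < dim_col (u i \<cdot>\<^sub>m B)"
      then have rc: "r < 1 + m" "c < 1 + m" using B by auto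
      have "?D i $$ (r, c) = (if r < 1 then if c < 1 then u i * \<mu> else 0
          else if c < 1 then 0 else (u i \<cdot>\<^sub>m H') $$ (r - 1, c - 1))"
        using rc H' by (subst tuple_direct_sum_index[of _ i 1 _ m]) auto
      also have "\<dots> = (u i \<cdot>\<^sub>m B) $$ (r, c)"
        using rc B Bc0 Br0 by (auto simp: H'_def)
      finally show "?D i $$ (r, c) = (u i \<cdot>\<^sub>m B) $$ (r, c)" .
    qed (use B H' in \<open>auto simp: tuple_direct_sum_def Let_def\<close>)
  qed
  ultimately have "(\<lambda>i. u i \<cdot>\<^sub>m B) \<in> T (Suc m)" by simp
  \<comment> \<open>The change of basis is undone with \<open>mat_adjoint U\<close> as the isometry;
    its isometry condition reads U U* = I.\<close>
  from matrix_convex_isometry[OF T _ _ this U'] UU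
  have "(\<lambda>i. U * (u i \<cdot>\<^sub>m B) * ?U) \<in> T (Suc m)" by simp
  moreover have "U * (u i \<cdot>\<^sub>m B) * ?U = u i \<cdot>\<^sub>m H" for i
  proof -
    have "U * (u i \<cdot>\<^sub>m B) * ?U = u i \<cdot>\<^sub>m (U * B * ?U)"
      using U(1) U' B by (simp add: mult_smult_distrib[OF U(1) B]
          mult_smult_assoc_mat[of "U * B" "Suc m" "Suc m" ?U "Suc m"])
    also have "U * B = U * ?U * (H * U)"
      unfolding B_def assoc_mult_mat[OF U' H U(1)]
      using assoc_mult_mat[OF U(1) U' mult_carrier_mat[OF H U(1)]] by simp
    also have "\<dots> = H * U" using UU H U(1) by simp
    also have "H * U * ?U = H" using assoc_mult_mat[OF H U(1) U'] UU H by simp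
    finally show ?thesis .
  qed
  ultimately show ?case by simp
qed

section \<open>Rank one matrices acting on tuples\<close>

text \<open>The range of A lies on a line. The vector u spans it, and v j is the coefficient of the
  j-th column of A along u.\<close>

lemma rank_one_outer_product:
  fixes A :: "real ^ 'n ^ 'm"
  assumes "rank A = 1"
  obtains u v where "\<And>i j. A $ i $ j = u $ i * v $ j"
proof -
  have "dim (range (\<lambda>x. A *v x)) = 1"
    using assms by (simp add: rank_dim_range)
  then obtain B where B: "range (\<lambda>x. A *v x) \<subseteq> span B" "card B = 1"
    using basis_exists[of "range (\<lambda>x. A *v x)"] by metis
  then obtain u where "B = {u}" by (auto simp: card_1_singleton_iff)
  then have "\<forall>j. \<exists>c. A *v axis j 1 = c *\<^sub>R u"
    using B by (auto simp: span_singleton)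
  then obtain v where v: "A *v axis j 1 = v j *\<^sub>R u" for j by metis
  have "A $ i $ j = u $ i * (\<chi> j. v j) $ j" for i j
    using arg_cong[OF v[of j], of "\<lambda>x. x $ i"]
    by (simp add: matrix_vector_mult_basis column_def)
  then show thesis using that by blast
qed

text \<open>The product M X. It is formed entrywise, so that the sum over j is one of complex
  numbers and not of matrices, whose zero depends on the size n.\<close>

definition tuple_action :: "nat \<Rightarrow> real ^ 'd ^ 'd \<Rightarrow> ('d::finite \<Rightarrow> complex mat) \<Rightarrow> 'd \<Rightarrow> complex mat" where
  "tuple_action n M X i = Matrix.mat n n (\<lambda>rc. \<Sum>j\<in>UNIV. of_real (M $ i $ j) * X j $$ rc)"

text \<open>This reduces to \<open>rank_one_tuple_mem\<close>: the value of H at a unit vector is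
  the scalar product of v with a point x of \<open>first_level S\<close>, and multiplying it by the
  entries of u gives the coordinates of M x, a point of \<open>first_level T\<close>.\<close>

lemma tuple_action_rank_one_mem:
  fixes S T :: "nat \<Rightarrow> ('d::finite \<Rightarrow> complex mat) set" and M :: "real ^ 'd ^ 'd"
  assumes S: "matrix_convex S" and T: "matrix_convex T" and n: "1 \<le> n" and X: "X \<in> S n"
    and rank: "rank M = 1" and M: "\<And>x. x \<in> first_level S \<Longrightarrow> M *v x \<in> first_level T"
  shows "tuple_action n M X \<in> T n"
proof -
  obtain u v where uv: "\<And>i j. M $ i $ j = u $ i * v $ j"
    using rank_one_outer_product[OF rank] by blast
  have Xc: "X i \<in> carrier_mat n n" and Xsa: "mat_adjoint (X i) = X i" for i
    using S n X unfolding matrix_convex_def sa_tuples_def by blast+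
  have Xcnj: "cnj (X i $$ (c, r)) = X i $$ (r, c)" if "r < n" "c < n" for i r c
    using arg_cong[OF Xsa[of i], of "\<lambda>M. M $$ (r, c)"] Xc[of i] that by simp
  define H where "H = Matrix.mat n n (\<lambda>rc. \<Sum>j\<in>UNIV. complex_of_real (v $ j) * X j $$ rc)"
  have H: "H \<in> carrier_mat n n" by (simp add: H_def)
  have Hsa: "mat_adjoint H = H"
    by (rule eq_matI) (auto simp: H_def Xcnj)
  have "(\<lambda>i. of_real (u $ i) \<cdot>\<^sub>m H) \<in> T n"
  proof (rule rank_one_tuple_mem[OF T n H Hsa])
    fix e :: "complex Matrix.vec"
    assume e: "e \<in> carrier_vec n" "e \<bullet>c e = 1"
    \<comment> \<open>The first-level point to which X compresses along e. Taking real parts loses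
      nothing, since each X j is self-adjoint.\<close>
    define x where "x = (\<chi> j. Re ((X j *\<^sub>v e) \<bullet>c e))"
    have x: "(X j *\<^sub>v e) \<bullet>c e = of_real (x $ j)" for j
    proof -
      let ?q = "(X j *\<^sub>v e) \<bullet>c e"
      have "?q = (\<Sum>p<n. \<Sum>q<n. X j $$ (p, q) * Matrix.vec_index e q * cnj (Matrix.vec_index e p))"
        by (rule cscalar_prod_mult_mat_vec[OF Xc e(1) e(1)])
      also have "\<dots> = (\<Sum>q<n. \<Sum>p<n. X j $$ (p, q) * Matrix.vec_index e q * cnj (Matrix.vec_index e p))"
        by (rule sum.swap)
      also have "\<dots> = cnj ?q"
        by (simp add: cscalar_prod_mult_mat_vec[OF Xc e(1) e(1)] Xcnj mult_ac)
      finally have "cnj ?q = ?q" ..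
      then show ?thesis by (auto simp: x_def complex_eq_iff)
    qed
    \<comment> \<open>The single column e is an isometry from dimension 1 because e has unit
      length.\<close>
    let ?V = "mat_of_cols n [e]"
    have V: "?V \<in> carrier_mat n 1" by (simp add: mat_of_cols_def)
    have "mat_adjoint ?V * ?V = 1\<^sub>m 1"
    proof (rule eq_matI)
      fix i j assume "i < dim_row (1\<^sub>m 1 :: complex mat)" "j < dim_col (1\<^sub>m 1 :: complex mat)"
      then have "i = 0" "j = 0" by auto
      then show "(mat_adjoint ?V * ?V) $$ (i, j) = 1\<^sub>m 1 $$ (i, j)"
        using e by (simp add: scalar_prod_def mat_of_cols_def mult.commute)
    qed (use V in auto)
    from matrix_convex_isometry[OF S n _ X V this]
    have "(\<lambda>i. mat_adjoint ?V * X i * ?V) \<in> S 1" by simp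
    moreover have "mat_adjoint ?V * X i * ?V = Matrix.mat 1 1 (\<lambda>_. of_real (x $ i))" for i
    proof (rule eq_matI)
      fix r c assume "r < dim_row (Matrix.mat 1 1 (\<lambda>_. complex_of_real (x $ i)))"
        "c < dim_col (Matrix.mat 1 1 (\<lambda>_. complex_of_real (x $ i)))"
      then have rc: "r = 0" "c = 0" by auto
      have "(mat_adjoint ?V * X i * ?V) $$ (0, 0) =
          (\<Sum>s<n. \<Sum>r<n. cnj (?V $$ (r, 0)) * X i $$ (r, s) * ?V $$ (s, 0))"
        by (rule congruence_index[OF Xc V]) auto
      also have "\<dots> = (\<Sum>r<n. \<Sum>s<n. cnj (?V $$ (r, 0)) * X i $$ (r, s) * ?V $$ (s, 0))"
        by (rule sum.swap)
      also have "\<dots> = (X i *\<^sub>v e) \<bullet>c e"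
        by (simp add: cscalar_prod_mult_mat_vec[OF Xc e(1) e(1)] mat_of_cols_def mult_ac)
      finally show "(mat_adjoint ?V * X i * ?V) $$ (r, c) = Matrix.mat 1 1 (\<lambda>_. complex_of_real (x $ i)) $$ (r, c)"
        by (simp add: rc x)
    qed (use V in auto)
    ultimately have "x \<in> first_level S" by (simp add: first_level_def)
    then have Mx: "M *v x \<in> first_level T" by (rule M)
    \<comment> \<open>The form is linear in H, so its value at e is the sum of the v_j x_j; a factor
      u_i turns this into coordinate i of M x.\<close>
    have "(H *\<^sub>v e) \<bullet>c e =
        (\<Sum>p<n. \<Sum>q<n. H $$ (p, q) * Matrix.vec_index e q * cnj (Matrix.vec_index e p))"
      by (rule cscalar_prod_mult_mat_vec[OF H e(1) e(1)])
    also have "\<dots> = (\<Sum>p<n. \<Sum>q<n. \<Sum>j\<in>UNIV. of_real (v $ j) *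
        (X j $$ (p, q) * Matrix.vec_index e q * cnj (Matrix.vec_index e p)))"
      by (intro sum.cong refl) (simp add: H_def sum_distrib_right mult.assoc)
    also have "\<dots> = (\<Sum>p<n. \<Sum>j\<in>UNIV. \<Sum>q<n. of_real (v $ j) *
        (X j $$ (p, q) * Matrix.vec_index e q * cnj (Matrix.vec_index e p)))"
      by (intro sum.cong refl sum.swap)
    also have "\<dots> = (\<Sum>j\<in>UNIV. \<Sum>p<n. \<Sum>q<n. of_real (v $ j) *
        (X j $$ (p, q) * Matrix.vec_index e q * cnj (Matrix.vec_index e p)))"
      by (rule sum.swap)
    also have "\<dots> = (\<Sum>j\<in>UNIV. of_real (v $ j) * of_real (x $ j))"
      by (simp add: x[symmetric] cscalar_prod_mult_mat_vec[OF Xc e(1) e(1)] sum_distrib_left)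
    finally have "of_real (u $ i) * ((H *\<^sub>v e) \<bullet>c e) = complex_of_real ((M *v x) $ i)" for i
      by (simp add: matrix_vector_mult_def uv sum_distrib_left mult_ac)
    with Mx show "(\<lambda>i. Matrix.mat 1 1 (\<lambda>_. of_real (u $ i) * ((H *\<^sub>v e) \<bullet>c e))) \<in> T 1"
      by (simp add: first_level_def)
  qed
  moreover have "tuple_action n M X = (\<lambda>i. of_real (u $ i) \<cdot>\<^sub>m H)"
    by (intro ext eq_matI) (auto simp: tuple_action_def H_def uv sum_distrib_left mult_ac)
  ultimately show ?thesis by simp
qed

section \<open>Averaging over the rank one matrices\<close>

theorem theorem7p16:
  fixes S :: "nat \<Rightarrow> ('d::finite \<Rightarrow> complex mat) set"
    and C :: real
    and k :: nat
    and lam :: "nat \<Rightarrow> real ^ 'd ^ 'd"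
  assumes "matrix_convex S"
    and "C > 0"
    and "\<forall>m\<in>{1..k}. rank (lam m) = 1"
    and "Finite_Cartesian_Product.mat 1 \<in> convex hull (lam ` {1..k})"
    and "\<forall>m\<in>{1..k}. (\<lambda>x. lam m *v x) ` first_level S \<subseteq> (\<lambda>x. C *\<^sub>R x) ` first_level S"
  shows "\<forall>T :: nat \<Rightarrow> ('d \<Rightarrow> complex mat) set. matrix_convex T \<longrightarrow>
           first_level S \<subseteq> first_level T \<longrightarrow> levels_subset S (scale_levels C T)"
proof (intro allI impI)
  fix T :: "nat \<Rightarrow> ('d \<Rightarrow> complex mat) set"
  assume T: "matrix_convex T" and ST: "first_level S \<subseteq> first_level T"
  show "levels_subset S (scale_levels C T)"
    unfolding levels_subset_def
  proof (intro allI impI subsetI)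
    fix n X assume n: "1 \<le> n" and X: "X \<in> S n"
    have Xc: "X i \<in> carrier_mat n n" for i
      using assms(1) n X unfolding matrix_convex_def sa_tuples_def by blast
    \<comment> \<open>Since X = C Y, it suffices to place Y in \<open>T n\<close>.\<close>
    define Y where "Y i = complex_of_real (1 / C) \<cdot>\<^sub>m X i" for i
    \<comment> \<open>M \<mapsto> M Y is linear and \<open>T n\<close> is convex, so this set is
      convex; once it contains every \<open>lam m\<close>, it contains their convex hull and with it
      the identity.\<close>
    let ?K = "{M. tuple_action n M Y \<in> T n}"
    have "lam m \<in> ?K" if m: "m \<in> {1..k}" for m
    proof -
      \<comment> \<open>The factor 1 / C moves from the tuple to the matrix. If
        \<open>lam m *v x\<close> is C y with y in \<open>first_level S\<close>, the scaled matrix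
        sends x to y, which lies in \<open>first_level T\<close>.\<close>
      have "tuple_action n ((1 / C) *\<^sub>R lam m) X \<in> T n"
      proof (rule tuple_action_rank_one_mem[OF assms(1) T n X])
        \<comment> \<open>The rank is the dimension of the range, and the range is unchanged because
          a nonzero factor can be absorbed into the argument.\<close>
        have "range (\<lambda>x. ((1 / C) *\<^sub>R lam m) *v x) = range (\<lambda>x. lam m *v x)"
        proof (rule subset_antisym; rule image_subsetI)
          fix x
          have "((1 / C) *\<^sub>R lam m) *v x = lam m *v ((1 / C) *\<^sub>R x)"
            by (simp add: matrix_vector_mult_def)
          then show "((1 / C) *\<^sub>R lam m) *v x \<in> range (\<lambda>x. lam m *v x)" by (rule range_eqI)
        next
          fix x
          have "lam m *v x = ((1 / C) *\<^sub>R lam m) *v (C *\<^sub>R x)"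
            using assms(2) by (simp add: matrix_vector_mult_def)
          then show "lam m *v x \<in> range (\<lambda>x. ((1 / C) *\<^sub>R lam m) *v x)" by (rule range_eqI)
        qed
        then show "rank ((1 / C) *\<^sub>R lam m) = 1"
          using assms(3) m by (simp add: rank_dim_range)
        fix x assume "x \<in> first_level S"
        then obtain y where "y \<in> first_level S" "lam m *v x = C *\<^sub>R y"
          using assms(5) m by blast
        moreover have "((1 / C) *\<^sub>R lam m) *v x = (1 / C) *\<^sub>R (lam m *v x)"
          by (simp add: matrix_vector_mult_def Finite_Cartesian_Product.vec_eq_iff sum_divide_distrib)
        ultimately show "((1 / C) *\<^sub>R lam m) *v x \<in> first_level T"
          using ST assms(2) by auto
      qed
      moreover have "tuple_action n ((1 / C) *\<^sub>R lam m) X = tuple_action n (lam m) Y"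
        by (intro ext eq_matI) (auto simp: tuple_action_def Y_def carrier_matD[OF Xc] intro!: sum.cong)
      ultimately show ?thesis by simp
    qed
    moreover have "convex ?K"
    proof (rule convexI)
      fix M N and a b :: real
      assume "M \<in> ?K" "N \<in> ?K" and ab: "0 \<le> a" "0 \<le> b" "a + b = 1"
      then have "(\<lambda>i. of_real a \<cdot>\<^sub>m tuple_action n M Y i + of_real b \<cdot>\<^sub>m tuple_action n N Y i) \<in> T n"
        using matrix_convex_convex_comb[OF T n] by simp
      moreover have "(\<lambda>i. of_real a \<cdot>\<^sub>m tuple_action n M Y i + of_real b \<cdot>\<^sub>m tuple_action n N Y i) =
          tuple_action n (a *\<^sub>R M + b *\<^sub>R N) Y"
        by (intro ext eq_matI) (auto simp: tuple_action_def algebra_simps sum_distrib_left sum.distrib)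
      ultimately show "a *\<^sub>R M + b *\<^sub>R N \<in> ?K" by simp
    qed
    ultimately have "convex hull (lam ` {1..k}) \<subseteq> ?K"
      by (intro hull_minimal) auto
    with assms(4) have "tuple_action n (Finite_Cartesian_Product.mat 1) Y \<in> T n" by blast
    moreover have "tuple_action n (Finite_Cartesian_Product.mat 1) Y = Y"
    proof (intro ext eq_matI)
      fix i r c assume "r < dim_row (Y i)" "c < dim_col (Y i)"
      moreover have "(\<Sum>j\<in>UNIV. complex_of_real ((Finite_Cartesian_Product.mat 1 :: real ^ 'd ^ 'd) $ i $ j)
          * Y j $$ (r, c)) = (\<Sum>j\<in>UNIV. if i = j then Y j $$ (r, c) else 0)"
        by (intro sum.cong) (auto simp: Finite_Cartesian_Product.mat_def)
      ultimately show "tuple_action n (Finite_Cartesian_Product.mat 1) Y i $$ (r, c) = Y i $$ (r, c)"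
        using Xc[of i] by (simp add: tuple_action_def Y_def)
    qed (auto simp: tuple_action_def Y_def carrier_matD[OF Xc])
    ultimately have "Y \<in> T n" by simp
    moreover have "X = (\<lambda>i. complex_of_real C \<cdot>\<^sub>m Y i)"
      using assms(2) by (intro ext eq_matI) (auto simp: Y_def)
    ultimately show "X \<in> scale_levels C T n"
      unfolding scale_levels_def by blast
  qed
qed

end
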